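(* Let $T$ be an almost steep rank-one transformation such that $$\sum_{n=0}^\infty \frac{1}{r_n}<\infty .$$ Then $T$ is not rationally weakly mixing.
   Context: Rank-one transformations. A column is a finite ordered collection of pairwise disjoint intervals of $\mathbb{R}$ (called levels), all of the same length, thought of as stacked on top of each other. The column map $T_C$ of a column $C$ sends each point of a level other than the top one to the point directly above it in the next level (by translation); it is undefined on the top level. A rank-one (cutting-and-stacking) transformation $T$ is given by a sequence of columns $C_n$, $n\ge 0$: $C_0$ consists of the single level $I=(0,1)$; $C_{n+1}$ is obtained from $C_n$ by cutting $C_n$ into $r_n\ge 2$ subcolumns of equal width (numbered $0,\dots,r_n-1$ from left to right), adding $s_{n,k}\ge 0$ new levels ("spacers", new disjoint intervals) above the $k$-th subcolumn, and stacking every subcolumn under the subcolumn to its right. $X$ is the union of all levels of all columns, with Lebesgue measure $\mu$ and its Borel $\sigma$-algebra, and the levels are required to form a generating semiring for the $\sigma$-algebra. $T_{C_{n+1}}$ extends $T_{C_n}$, and $T$ is the limit of the $T_{C_n}$; it is an invertible measure-preserving transformation of $X$ (mod null sets). $h_n$ denotes the number of levels of $C_n$, and $h_{n,k}=h_n+s_{n,k}$. $T$ is called almost steep if for every $n\ge 0$: (a) $r_n\ge 3$; (b) $s_{n,0}=0$ and $s_{n,1}=1$; (c) $\sum_{k=0}^{i}h_{n,k}\ge 4\left(\sum_{k=0}^{i-1}h_{n,k}\right)$ for every $2\le i\le r_n-1$. For measurable $F$ with $0<\mu(F)<\infty$, $u_k(F)=\mu(F\cap T^kF)/\mu(F)^2$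 and $a_n(F)=\sum_{k=0}^{n-1}u_k(F)$. $T$ is rationally weakly mixing if there exists a measurable $F\subset X$ with $0<\mu(F)<\infty$ such that for all measurable $A,B\subset F$, $$\frac{1}{a_n(F)}\sum_{k=0}^{n-1}\left|\mu(A\cap T^kB)-\mu(A)\mu(B)u_k(F)\right|\to 0\quad\text{as } n\to\infty.$$ *)

theory Defs
  imports "HOL-Analysis.Analysis"
begin

text \<open>
  A column is stored as the common width of its levels and the list of their left endpoints, from
  bottom to top. Levels are open intervals, in line with the initial level (0,1), so cutting a level
  discards finitely many cut points. Everything below is understood modulo null sets.
\<close>

datatype column = Column (width: real) (bases: "real list")

definition height :: "column \<Rightarrow> nat" where
  "height C = length (bases C)"

definition level :: "column \<Rightarrow> nat \<Rightarrow> real set" where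
  "level C i = {bases C ! i <..< bases C ! i + width C}"

definition is_column :: "column \<Rightarrow> bool" where
  "is_column C \<longleftrightarrow> 0 < width C \<and> disjoint_family_on (level C) {..<height C}"

definition column_map :: "column \<Rightarrow> real \<Rightarrow> real option" where
  "column_map C x =
    (if \<exists>i. Suc i < height C \<and> x \<in> level C i
     then let i = (THE i. Suc i < height C \<and> x \<in> level C i)
          in Some (x + (bases C ! Suc i - bases C ! i))
     else None)"

definition subcolumn_bases :: "nat \<Rightarrow> column \<Rightarrow> nat \<Rightarrow> real list" where
  "subcolumn_bases r C k = map (\<lambda>a. a + real k * (width C / real r)) (bases C)"

text \<open>
  \<open>sp k\<close> lists the left endpoints of the spacers put above the \<open>k\<close>-th subcolumn. The condition
  \<open>is_column C'\<close> makes the spacers disjoint from each other and from all cut levels. An open spacer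
  disjoint from the cut levels cannot contain a cut point either, so it is disjoint from every
  level of every earlier column.
\<close>

definition cut_and_stack :: "nat \<Rightarrow> (nat \<Rightarrow> nat) \<Rightarrow> column \<Rightarrow> column \<Rightarrow> bool" where
  "cut_and_stack r s C C' \<longleftrightarrow>
     (\<exists>sp. (\<forall>k<r. length (sp k) = s k) \<and>
           width C' = width C / real r \<and>
           bases C' = concat (map (\<lambda>k. subcolumn_bases r C k @ sp k) [0..<r]) \<and>
           is_column C')"

definition cutting_and_stacking ::
    "(nat \<Rightarrow> nat) \<Rightarrow> (nat \<Rightarrow> nat \<Rightarrow> nat) \<Rightarrow> (nat \<Rightarrow> column) \<Rightarrow> bool" where
  "cutting_and_stacking r s C \<longleftrightarrow>
     C 0 = Column 1 [0] \<and> (\<forall>n. r n \<ge> 2 \<and> cut_and_stack (r n) (s n) (C n) (C (Suc n)))"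

definition levels :: "(nat \<Rightarrow> column) \<Rightarrow> real set set" where
  "levels C = {level (C n) i | n i. i < height (C n)}"

definition column_space :: "(nat \<Rightarrow> column) \<Rightarrow> real measure" where
  "column_space C = restrict_space lborel (\<Union>(levels C))"

text \<open>
  The semiring axioms hold for \<open>levels C\<close> by construction, up to cut points: two levels are disjoint
  or nested, and a level is a finite disjoint union of levels of any later column. Only the
  generation requirement is spelled out.
\<close>

definition levels_generate :: "(nat \<Rightarrow> column) \<Rightarrow> bool" where
  "levels_generate C \<longleftrightarrow>
     (\<forall>A\<in>sets (column_space C). \<exists>B\<in>sigma_sets (space (column_space C)) (levels C).
        sym_diff A B \<in> null_sets (column_space C))"

definition invertible_mpt :: "'a measure \<Rightarrow> ('a \<Rightarrow> 'a) \<Rightarrow> bool" where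
  "invertible_mpt M T \<longleftrightarrow>
     bij_betw T (space M) (space M) \<and>
     T \<in> measurable M M \<and> the_inv_into (space M) T \<in> measurable M M \<and>
     (\<forall>A\<in>sets M. emeasure M (T -` A \<inter> space M) = emeasure M A)"

text \<open>
  The column maps determine their limit only almost everywhere; \<open>T\<close> is any version of it that is
  an honest bijection of the space, so that \<open>T^k F\<close> is an image of a measurable set under a
  bimeasurable map.
\<close>

definition rank_one ::
    "(nat \<Rightarrow> nat) \<Rightarrow> (nat \<Rightarrow> nat \<Rightarrow> nat) \<Rightarrow> (nat \<Rightarrow> column) \<Rightarrow> (real \<Rightarrow> real) \<Rightarrow> bool" where
  "rank_one r s C T \<longleftrightarrow>
     cutting_and_stacking r s C \<and> levels_generate C \<and>
     invertible_mpt (column_space C) T \<and>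
     (AE x in column_space C. \<forall>\<^sub>F n in sequentially. column_map (C n) x = Some (T x))"

definition almost_steep ::
    "(nat \<Rightarrow> nat) \<Rightarrow> (nat \<Rightarrow> nat \<Rightarrow> nat) \<Rightarrow> (nat \<Rightarrow> column) \<Rightarrow> bool" where
  "almost_steep r s C \<longleftrightarrow>
     (\<forall>n. r n \<ge> 3 \<and> s n 0 = 0 \<and> s n 1 = 1 \<and>
        (\<forall>i. 2 \<le> i \<and> i \<le> r n - 1 \<longrightarrow>
           (\<Sum>k=0..i. height (C n) + s n k) \<ge> 4 * (\<Sum>k=0..i-1. height (C n) + s n k)))"

definition u_coeff :: "'a measure \<Rightarrow> ('a \<Rightarrow> 'a) \<Rightarrow> 'a set \<Rightarrow> nat \<Rightarrow> real" where
  "u_coeff M T F k = measure M (F \<inter> (T ^^ k) ` F) / (measure M F)\<^sup>2"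

definition a_coeff :: "'a measure \<Rightarrow> ('a \<Rightarrow> 'a) \<Rightarrow> 'a set \<Rightarrow> nat \<Rightarrow> real" where
  "a_coeff M T F n = (\<Sum>k<n. u_coeff M T F k)"

definition rationally_weakly_mixing :: "'a measure \<Rightarrow> ('a \<Rightarrow> 'a) \<Rightarrow> bool" where
  "rationally_weakly_mixing M T \<longleftrightarrow>
     (\<exists>F\<in>sets M. 0 < emeasure M F \<and> emeasure M F < \<infinity> \<and>
        (\<forall>A\<in>sets M. \<forall>B\<in>sets M. A \<subseteq> F \<longrightarrow> B \<subseteq> F \<longrightarrow>
           (\<lambda>n. 1 / a_coeff M T F n *
                (\<Sum>k<n. \<bar>measure M (A \<inter> (T ^^ k) ` B) -
                        measure M A * measure M B * u_coeff M T F k\<bar>))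
             \<longlonglongrightarrow> 0))"

end

theory Submission
  imports Defs
begin

text \<open>
  Write the heights in \<open>C\<^sub>n\<close> of the copies of a level of \<open>C\<^sub>m\<close> as sums of offsets, one subcolumn index
  per stage. Apart from the first two subcolumns of each stage the offsets grow at least by a factor
  four, so the time between two copies built from the remaining indices determines the height
  difference of the levels of \<open>C\<^sub>m\<close> that they are copies of, and
  \<open>\<Sum> 1 / r\<^sub>n < \<infinity>\<close> makes almost all heights of this kind once \<open>m\<close> is large. All these heights lie in the
  lower half of \<open>C\<^sub>n\<close>, hence up to time \<open>h\<^sub>n / 2\<close> no orbit segment leaves the column.

  If \<open>F\<close> witnessed rational weak mixing, pick two levels \<open>J \<noteq> J'\<close> of \<open>C\<^sub>m\<close> almost filled by \<open>F\<close>, and let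
  \<open>A = F \<inter> J\<close>, \<open>B = F \<inter> J'\<close>. On the set of times that are decodable returns of \<open>J\<close> to itself, the sum of
  \<open>\<mu>(A \<inter> T\<^sup>k A)\<close> is comparable to the maximum possible one, while that of \<open>\<mu>(A \<inter> T\<^sup>k B)\<close> is
  negligible. But both should be proportional to the sum of the \<open>u\<^sub>k(F)\<close>.
\<close>

section \<open>Concatenated lists and counting of differences\<close>

lemma length_concat_map_upt: "length (concat (map f [0..<j])) = (\<Sum>k<j. length (f k))"
  by (induction j) simp_all

lemma nth_concat_map_upt:
  assumes "j < r" "i < length (f j)"
  shows "concat (map f [0..<r]) ! ((\<Sum>k<j. length (f k)) + i) = f j ! i"
  using assms
proof (induction r)
  case (Suc r)
  have "(\<Sum>k<j. length (f k)) + i < (\<Sum>k<r. length (f k))" if "j < r"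
  proof -
    have "(\<Sum>k<j. length (f k)) + i < (\<Sum>k<Suc j. length (f k))"
      using Suc.prems by simp
    also have "\<dots> \<le> (\<Sum>k<r. length (f k))"
      using that by (intro sum_mono2) auto
    finally show ?thesis .
  qed
  then show ?case
    using Suc by (cases "j = r") (auto simp: nth_append length_concat_map_upt[symmetric] simp del: length_concat)
qed simp

text \<open>A time \<open>k\<close> and a starting height \<open>d\<close> determine
  \<open>e\<close>, and \<open>(d, e)\<close> gives back \<open>k\<close>, so summing over times
  counts each pair at most once. \<open>P\<close> stays free because both all pairs and only the
  non-decodable pairs are counted later.\<close>

lemma sum_card_shift_le:
  fixes x y :: nat
  assumes "finite K" "finite E" "finite P"
    and "\<And>k d e. k \<in> K \<Longrightarrow> d \<in> E \<Longrightarrow> e \<in> E \<Longrightarrow> y + d + k = x + e \<Longrightarrow> (d, e) \<in> P"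
  shows "(\<Sum>k\<in>K. card {d \<in> E. \<exists>e\<in>E. y + d + k = x + e}) \<le> card P"
proof -
  let ?S = "SIGMA k:K. {d \<in> E. \<exists>e\<in>E. y + d + k = x + e}"
  have "(\<Sum>k\<in>K. card {d \<in> E. \<exists>e\<in>E. y + d + k = x + e}) = card ?S"
    using assms(1,2) by (subst card_SigmaI) auto
  also have "\<dots> \<le> card P"
  proof (rule card_inj_on_le)
    show "inj_on (\<lambda>(k, d). (d, y + d + k - x)) ?S"
      by (auto simp: inj_on_def)
    show "(\<lambda>(k, d). (d, y + d + k - x)) ` ?S \<subseteq> P"
      using assms(4) by auto
  qed fact
  finally show ?thesis .
qed

text \<open>The double sum runs over the pairs \<open>d \<le> e\<close> in \<open>G\<close>, with
  \<open>k = e - d\<close>; by symmetry these are at least half of all pairs. In the application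
  \<open>c\<close> is the width of a level and \<open>f\<close> the measure of what the set misses
  in it.\<close>

lemma sum_ordered_pairs_ge:
  fixes f :: "nat \<Rightarrow> real" and G :: "nat set" and c :: real
  assumes G: "finite G" "G \<subseteq> {..<N}" and f: "\<And>d. 0 \<le> f d" and "0 \<le> c"
  shows "c * (card G)\<^sup>2 / 2 - 2 * card G * sum f G
    \<le> (\<Sum>k | k < N \<and> (\<exists>d\<in>G. d + k \<in> G). \<Sum>d | d \<in> G \<and> d + k \<in> G. c - f d - f (d + k))"
proof -
  let ?K = "{k. k < N \<and> (\<exists>d\<in>G. d + k \<in> G)}"
  let ?R = "{p \<in> G \<times> G. fst p \<le> snd p}" and ?R' = "{p \<in> G \<times> G. snd p \<le> fst p}"
  have fin: "finite ?R" "finite ?R'" using G(1) by auto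
  have witness: "\<exists>d\<in>G. d + b - a \<in> G" if "a \<in> G" "b \<in> G" for a b
    using that by (intro bexI[of _ a]) auto
  have "bij_betw prod.swap ?R ?R'"
    by (rule bij_betw_byWitness[where f' = prod.swap]) auto
  then have "card ?R = card ?R'" by (rule bij_betw_same_card)
  moreover have "card (G \<times> G) \<le> card ?R + card ?R'"
  proof -
    have "card (G \<times> G) \<le> card (?R \<union> ?R')"
      by (rule card_mono) (use fin in auto)
    then show ?thesis
      using card_Un_le[of ?R ?R'] by (rule order_trans)
  qed
  ultimately have "card G * card G \<le> 2 * card ?R"
    by (simp add: card_cartesian_product)
  then have R: "(real (card G))\<^sup>2 / 2 \<le> card ?R"
    by (simp add: power2_eq_square flip: of_nat_mult)
  have "c * (card G)\<^sup>2 / 2 - 2 * card G * sum f G \<le> c * card ?R - (\<Sum>p\<in>G \<times> G. f (fst p) + f (snd p))"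
    using mult_left_mono[OF R \<open>0 \<le> c\<close>]
    by (simp add: sum.cartesian_product' sum.distrib sum_distrib_left[symmetric]
        sum_distrib_right[symmetric] mult.commute)
  \<comment> \<open>Every loss occurs in at most \<open>card G\<close> pairs on either side;
    restricting to ordered pairs only reduces the loss.\<close>
  also have "\<dots> \<le> c * card ?R - (\<Sum>p\<in>?R. f (fst p) + f (snd p))"
    using f G(1) by (intro diff_left_mono sum_mono2) auto
  also have "\<dots> = (\<Sum>p\<in>?R. c - f (fst p) - f (snd p))"
    by (simp add: sum_subtractf sum.distrib)
  also have "\<dots> = (\<Sum>p\<in>(SIGMA k:?K. {d. d \<in> G \<and> d + k \<in> G}). c - f (snd p) - f (snd p + fst p))"
    using G(2) witness
    by (intro sum.reindex_bij_witness[where i = "\<lambda>(k, d). (d, d + k)" and j = "\<lambda>(d, e). (e - d, d)"])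
      (auto intro: less_imp_diff_less)
  also have "\<dots> = (\<Sum>k\<in>?K. \<Sum>d | d \<in> G \<and> d + k \<in> G. c - f d - f (d + k))"
    using G(1) by (subst sum.Sigma) (auto simp: case_prod_unfold)
  finally show ?thesis .
qed

section \<open>Columns and the offsets of their subcolumns\<close>

locale almost_steep_rank_one =
  fixes r :: "nat \<Rightarrow> nat" and s :: "nat \<Rightarrow> nat \<Rightarrow> nat"
    and C :: "nat \<Rightarrow> column" and T :: "real \<Rightarrow> real"
  assumes rank_one: "rank_one r s C T" and almost_steep: "almost_steep r s C"
begin

abbreviation "h n \<equiv> height (C n)"
abbreviation "w n \<equiv> width (C n)"
abbreviation "M \<equiv> column_space C"

text \<open>The height in \<open>C (Suc n)\<close> at which the \<open>j\<close>-th subcolumn of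
  \<open>C n\<close> begins; for \<open>j = r n\<close> it is the full height.\<close>

definition offset :: "nat \<Rightarrow> nat \<Rightarrow> nat" where
  "offset n j = (\<Sum>k<j. h n + s n k)"

lemma r_ge3: "3 \<le> r n"
  using almost_steep by (auto simp: almost_steep_def)

lemma C_0: "C 0 = Column 1 [0]"
  using rank_one by (auto simp: rank_one_def cutting_and_stacking_def)

lemma cut: "cut_and_stack (r n) (s n) (C n) (C (Suc n))"
  using rank_one by (auto simp: rank_one_def cutting_and_stacking_def)

lemma width_Suc: "w (Suc n) = w n / real (r n)"
  using cut[of n] by (auto simp: cut_and_stack_def)

lemma is_column: "is_column (C n)"
proof (cases n)
  case 0
  then show ?thesis by (auto simp: C_0 is_column_def height_def disjoint_family_on_def)
next
  case (Suc m)
  then show ?thesis using cut[of m] by (auto simp: cut_and_stack_def)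
qed

lemma width_pos: "0 < w n"
  using is_column by (auto simp: is_column_def)

lemma bases_Suc:
  obtains sp where "\<And>k. k < r n \<Longrightarrow> length (sp k) = s n k"
    "bases (C (Suc n)) = concat (map (\<lambda>k. subcolumn_bases (r n) (C n) k @ sp k) [0..<r n])"
  using cut[of n] unfolding cut_and_stack_def by (elim exE conjE) blast

lemma height_Suc: "h (Suc n) = offset n (r n)"
proof -
  obtain sp where "\<And>k. k < r n \<Longrightarrow> length (sp k) = s n k"
    "bases (C (Suc n)) = concat (map (\<lambda>k. subcolumn_bases (r n) (C n) k @ sp k) [0..<r n])"
    using bases_Suc[of n] by blast
  then show ?thesis
    by (simp add: height_def length_concat_map_upt offset_def subcolumn_bases_def del: length_concat)
qed

lemma bases_Suc_nth:
  assumes "j < r n" "i < h n"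
  shows "bases (C (Suc n)) ! (offset n j + i) = bases (C n) ! i + real j * (w n / real (r n))"
proof -
  obtain sp where sp: "\<And>k. k < r n \<Longrightarrow> length (sp k) = s n k"
    "bases (C (Suc n)) = concat (map (\<lambda>k. subcolumn_bases (r n) (C n) k @ sp k) [0..<r n])"
    using bases_Suc[of n] by blast
  let ?f = "\<lambda>k. subcolumn_bases (r n) (C n) k @ sp k"
  have "offset n j = (\<Sum>k<j. length (?f k))"
    unfolding offset_def using sp(1) assms
    by (intro sum.cong) (auto simp: height_def subcolumn_bases_def)
  then have "bases (C (Suc n)) ! (offset n j + i) = ?f j ! i"
    unfolding sp(2) using assms nth_concat_map_upt[of j "r n" i ?f]
    by (simp only:) (simp add: height_def subcolumn_bases_def)
  also have "\<dots> = bases (C n) ! i + real j * (w n / real (r n))"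
    using assms(2) by (simp add: height_def subcolumn_bases_def nth_append)
  finally show ?thesis .
qed

lemma offset_Suc: "offset n (Suc j) = offset n j + h n + s n j"
  by (simp add: offset_def)

lemma offset_0 [simp]: "offset n 0 = 0"
  by (simp add: offset_def)

lemma offset_mono: "i < j \<Longrightarrow> offset n i + h n \<le> offset n j"
proof (induction j)
  case (Suc j)
  then show ?case by (cases "i = j") (auto simp: offset_Suc)
qed simp

lemma offset_2: "offset n 2 = 2 * h n + 1"
  using almost_steep by (simp add: almost_steep_def offset_def numeral_2_eq_2)

text \<open>Growth by four starts only at \<open>i = 2\<close>: the offsets before that are
  \<open>0\<close>, \<open>h n\<close> and \<open>2 * h n + 1\<close>, whose gaps differ by just
  one.\<close>

lemma offset_steep:
  assumes "2 \<le> i" "i < r n"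
  shows "4 * offset n i \<le> offset n (Suc i)"
proof -
  have "{..<i} = {0..i-1}" "{..<Suc i} = {0..i}"
    using assms by auto
  moreover have "(\<Sum>k=0..i. h n + s n k) \<ge> 4 * (\<Sum>k=0..i-1. h n + s n k)"
    using almost_steep assms by (auto simp: almost_steep_def)
  ultimately show ?thesis
    by (simp add: offset_def)
qed

lemma offset_steep_less:
  assumes "2 \<le> i" "i < j" "j \<le> r n"
  shows "4 * offset n i \<le> offset n j"
  using assms(2,3)
proof (induction j)
  case (Suc j)
  then show ?case
    using offset_steep[of i n] offset_mono[of j "Suc j" n] assms(1) by (cases "i = j") auto
qed simp

lemma height_ge: "Suc n \<le> h n"
proof (induction n)
  case 0
  then show ?case by (simp add: C_0 height_def)
next
  case (Suc n)
  have "offset n 2 \<le> offset n (r n)"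
    using offset_mono[of 2 "r n" n] r_ge3[of n] by simp
  then show ?case
    using Suc by (simp add: height_Suc offset_2)
qed

section \<open>Copies of a column inside later columns\<close>

text \<open>
  \<open>desc l m k\<close> lists the heights in column \<open>m + k\<close> of the copies of the base of column \<open>m\<close> that, at
  every stage in between, avoid the first \<open>l\<close> subcolumns. With \<open>l = 0\<close> these are all copies; with
  \<open>l = 2\<close> differences of such heights can be decoded, because the exceptional
  equal-up-to-one gaps of an almost steep column involve the first two subcolumns.
\<close>

primrec desc :: "nat \<Rightarrow> nat \<Rightarrow> nat \<Rightarrow> nat set" where
  "desc l m 0 = {0}"
| "desc l m (Suc k) = (\<lambda>(j, d). offset (m + k) j + d) ` ({l..<r (m + k)} \<times> desc l m k)"

lemma desc_le: "d \<in> desc l m k \<Longrightarrow> d + h m \<le> h (m + k)"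
proof (induction k arbitrary: d)
  case (Suc k)
  then obtain j d' where jd: "j < r (m + k)" "d' \<in> desc l m k" "d = offset (m + k) j + d'"
    by auto
  then show ?case
    using Suc.IH[of d'] offset_mono[of j "r (m + k)" "m + k"] by (simp add: height_Suc)
qed simp

text \<open>By steepness the last subcolumn starts within the lowest quarter of the new column. Its
  start is also at least the height of the old column, so it ends below one half.\<close>

lemma desc_le_half:
  assumes "d \<in> desc l m (Suc k)"
  shows "d + h m \<le> h (m + Suc k) div 2"
proof -
  obtain j d' where jd: "j < r (m + k)" "d' \<in> desc l m k" "d = offset (m + k) j + d'"
    using assms by auto
  define q where "q = r (m + k) - 1"
  have q: "2 \<le> q" "q < r (m + k)" "r (m + k) = Suc q" "j \<le> q"
    using r_ge3[of "m + k"] jd(1) by (auto simp: q_def)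
  have "offset (m + k) j \<le> offset (m + k) q"
    using offset_mono[of j q "m + k"] q by (cases "j = q") auto
  moreover have "h (m + k) \<le> offset (m + k) q"
    using offset_mono[of 0 q "m + k"] q by simp
  moreover have "4 * offset (m + k) q \<le> h (m + Suc k)"
    using offset_steep[OF q(1,2)] q(3) by (simp add: height_Suc)
  moreover have "d + h m \<le> offset (m + k) j + h (m + k)"
    using desc_le[OF jd(2)] jd(3) by simp
  ultimately show ?thesis by simp
qed

lemma finite_desc [simp]: "finite (desc l m k)"
  by (induction k) simp_all

lemma desc_mono: "desc l m k \<subseteq> desc 0 m k"
proof (induction k)
  case (Suc k)
  then show ?case
    unfolding desc.simps by (intro image_mono Sigma_mono) auto
qed simp

lemma card_desc: "card (desc l m k) = (\<Prod>i<k. r (m + i) - l)"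
proof (induction k)
  case (Suc k)
  have "inj_on (\<lambda>(j, d). offset (m + k) j + d) ({l..<r (m + k)} \<times> desc l m k)"
  proof (intro inj_onI, clarsimp)
    fix j d j' d'
    assume *: "d \<in> desc l m k" "d' \<in> desc l m k" "offset (m + k) j + d = offset (m + k) j' + d'"
    have "d < h (m + k)" "d' < h (m + k)"
      using desc_le[OF *(1)] desc_le[OF *(2)] height_ge[of m] by auto
    then show "j = j' \<and> d = d'"
      using *(3) offset_mono[of j j' "m + k"] offset_mono[of j' j "m + k"]
      by (cases j j' rule: linorder_cases) auto
  qed
  then show ?case
    using Suc by (simp add: card_image card_cartesian_product mult.commute)
qed simp

lemma width_card_desc: "w (m + k) * real (card (desc 0 m k)) = w m"
proof (induction k)
  case (Suc k)
  then show ?case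
    using r_ge3[of "m + k"] by (simp add: card_desc width_Suc del: desc.simps)
qed simp

text \<open>One shift \<open>c\<close> serves all levels at once: a copy of the whole column is a
  translate, so it has the same differences of left endpoints and hence the same column map. The
  bound on \<open>c\<close> keeps each copy inside its original level.\<close>

lemma bases_desc:
  assumes "d \<in> desc 0 m k"
  shows "\<exists>c\<ge>0. c + w (m + k) \<le> w m \<and>
           (\<forall>x<h m. bases (C (m + k)) ! (x + d) = bases (C m) ! x + c)"
  using assms
proof (induction k arbitrary: d)
  case (Suc k)
  then obtain j d' where jd: "j < r (m + k)" "d' \<in> desc 0 m k" "d = offset (m + k) j + d'"
    by auto
  obtain c where c: "c \<ge> 0" "c + w (m + k) \<le> w m"
    "\<And>x. x < h m \<Longrightarrow> bases (C (m + k)) ! (x + d') = bases (C m) ! x + c"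
    using Suc.IH[OF jd(2)] by auto
  define c' where "c' = c + real j * (w (m + k) / real (r (m + k)))"
  have "(real j + 1) * (w (m + k) / real (r (m + k))) \<le> real (r (m + k)) * (w (m + k) / real (r (m + k)))"
    using jd(1) width_pos[of "m + k"] by (intro mult_right_mono) auto
  then have "(real j + 1) * (w (m + k) / real (r (m + k))) \<le> w (m + k)"
    using r_ge3[of "m + k"] by simp
  then have "c' + w (m + Suc k) \<le> w m"
    using c(2) unfolding c'_def add_Suc_right width_Suc distrib_right by linarith
  moreover have "c' \<ge> 0"
    using c(1) width_pos[of "m + k"] by (simp add: c'_def)
  moreover have "bases (C (m + Suc k)) ! (x + d) = bases (C m) ! x + c'" if "x < h m" for x
    using bases_Suc_nth[OF jd(1), of "x + d'"] c(3)[OF that] desc_le[OF jd(2)] that jd(3)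
    by (simp add: c'_def algebra_simps)
  ultimately show ?case by blast
qed auto

declare desc.simps(2) [simp del]

lemma level_desc_subset:
  assumes "d \<in> desc 0 m k" "x < h m"
  shows "level (C (m + k)) (x + d) \<subseteq> level (C m) x"
  using bases_desc[OF assms(1)] assms(2) by (auto simp: level_def)

lemma level_disjoint:
  assumes "i < h n" "j < h n" "i \<noteq> j"
  shows "level (C n) i \<inter> level (C n) j = {}"
  using is_column[of n] assms by (auto simp: is_column_def disjoint_family_on_def)

lemma measure_level [simp]: "measure lborel (level (C n) i) = w n"
  using width_pos[of n] by (simp add: level_def)

lemma level_fmeasurable [simp]: "level (C n) i \<in> fmeasurable lborel"
  using width_pos[of n] by (auto simp: level_def fmeasurable_def less_top[symmetric])

lemma level_sets [measurable, simp]: "level (C n) i \<in> sets borel"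
  by (simp add: level_def)

text \<open>Only cut points are lost. They need not be named: the copies are disjoint and their
  widths add up to \<open>w m\<close>.\<close>

lemma level_desc_null:
  assumes "x < h m"
  shows "level (C m) x - (\<Union>d\<in>desc 0 m k. level (C (m + k)) (x + d)) \<in> null_sets lborel"
proof -
  let ?U = "\<Union>d\<in>desc 0 m k. level (C (m + k)) (x + d)"
  have "measure lborel ?U = (\<Sum>d\<in>desc 0 m k. measure lborel (level (C (m + k)) (x + d)))"
  proof (rule measure_finite_Union)
    show "disjoint_family_on (\<lambda>d. level (C (m + k)) (x + d)) (desc 0 m k)"
      unfolding disjoint_family_on_def using assms
      by (intro ballI impI level_disjoint) (auto dest: desc_le)
  qed (use fmeasurableD2[OF level_fmeasurable] in auto)
  also have "\<dots> = w m"
    using width_card_desc[of m k] by (simp add: mult.commute)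
  finally have "measure lborel (level (C m) x - ?U) = 0"
    using level_desc_subset[OF _ assms, of _ k]
    by (subst measurable_measure_Diff) auto
  then show ?thesis
    by (intro null_setsI) (auto simp: emeasure_eq_measure2[OF fmeasurable_Diff[OF level_fmeasurable]])
qed

section \<open>The measure space and the powers of \<open>T\<close>\<close>

lemma space_M: "space M = \<Union>(levels C)"
  by (simp add: column_space_def space_restrict_space)

lemma space_M_borel [measurable, simp]: "space M \<in> sets borel"
  unfolding space_M levels_def by (intro borel_open open_Union) (auto simp: level_def)

lemma level_subset_space: "i < h n \<Longrightarrow> level (C n) i \<subseteq> space M"
  by (auto simp: space_M levels_def)

lemma sets_M_iff: "A \<in> sets M \<longleftrightarrow> A \<subseteq> space M \<and> A \<in> sets borel"
  using space_M_borel unfolding space_M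
  by (simp add: column_space_def sets_restrict_space_iff)

lemma emeasure_M: "A \<in> sets M \<Longrightarrow> emeasure M A = emeasure lborel A"
  using space_M_borel sets_M_iff[of A] unfolding space_M
  by (simp add: column_space_def emeasure_restrict_space)

lemma measure_M: "A \<in> sets M \<Longrightarrow> measure M A = measure lborel A"
  by (simp add: measure_def emeasure_M)

lemma AE_M_iff: "(AE y in M. P y) \<longleftrightarrow> (AE y in lborel. y \<in> space M \<longrightarrow> P y)"
proof -
  have "\<Union>(levels C) \<in> sets borel"
    using space_M_borel by (simp only: space_M)
  then show ?thesis
    unfolding space_M unfolding column_space_def by (subst AE_restrict_space_iff) auto
qed

lemma invertible: "bij_betw T (space M) (space M)" "T \<in> measurable M M"
    "the_inv_into (space M) T \<in> measurable M M"
    "A \<in> sets M \<Longrightarrow> emeasure M (T -` A \<inter> space M) = emeasure M A"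
  using rank_one by (auto simp: rank_one_def invertible_mpt_def)

text \<open>In this form, invariance lets almost everywhere statements be pulled back along
  \<open>T\<close>.\<close>

lemma distr_T: "distr M M T = M"
  by (rule measure_eqI) (auto simp: emeasure_distr invertible)

lemma AE_T: "AE y in M. P y \<Longrightarrow> AE y in M. P (T y)"
  using AE_distrD[OF invertible(2), of P] unfolding distr_T .

lemma AE_T_pow: "AE y in M. P y \<Longrightarrow> AE y in M. P ((T ^^ k) y)"
proof (induction k arbitrary: P)
  case (Suc k)
  show ?case
    using Suc.IH[OF AE_T[OF Suc.prems]] by simp
qed simp

lemma T_pow_measurable: "T ^^ k \<in> measurable M M"
  by (induction k) (auto intro: measurable_compose[OF _ invertible(2)] simp: comp_def)

lemma T_pow_bij: "bij_betw (T ^^ k) (space M) (space M)"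
proof (induction k)
  case 0
  then show ?case by (simp add: bij_betw_id[unfolded id_def])
next
  case (Suc k)
  then show ?case
    unfolding funpow.simps by (rule bij_betw_trans[OF _ invertible(1)])
qed

lemma T_image_sets:
  assumes "A \<in> sets M" shows "T ` A \<in> sets M"
proof -
  have "T ` A \<subseteq> the_inv_into (space M) T -` A \<inter> space M"
    using sets.sets_into_space[OF assms] invertible(1)
    by (auto simp: bij_betw_def the_inv_into_f_f)
  moreover have "the_inv_into (space M) T -` A \<inter> space M \<subseteq> T ` A"
    using f_the_inv_into_f_bij_betw[OF invertible(1)] by force
  ultimately have "T ` A = the_inv_into (space M) T -` A \<inter> space M" by blast
  then show ?thesis
    using measurable_sets[OF invertible(3) assms] by simp
qed

lemma T_pow_image_sets: "A \<in> sets M \<Longrightarrow> (T ^^ k) ` A \<in> sets M"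
proof (induction k)
  case (Suc k)
  then show ?case
    unfolding funpow.simps image_comp[symmetric] by (intro T_image_sets)
qed simp

lemma emeasure_T_pow: "A \<in> sets M \<Longrightarrow> emeasure M ((T ^^ k) -` A \<inter> space M) = emeasure M A"
proof (induction k arbitrary: A)
  case (Suc k)
  have "(T ^^ Suc k) -` A \<inter> space M = (T ^^ k) -` (T -` A \<inter> space M) \<inter> space M"
    using T_pow_bij[of k] by (auto simp: bij_betw_def)
  then show ?case
    using Suc.IH[of "T -` A \<inter> space M"] measurable_sets[OF invertible(2) Suc.prems]
      invertible(4)[OF Suc.prems] by (simp only:)
qed (use sets.sets_into_space in \<open>auto simp: Int_absorb2\<close>)

text \<open>Passing from images to starting points in \<open>B\<close> allows pointwise almost
  everywhere arguments.\<close>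

lemma measure_Int_T_pow_image:
  assumes "A \<in> sets M" "B \<in> sets M"
  shows "measure M (A \<inter> (T ^^ k) ` B) = measure M {y \<in> B. (T ^^ k) y \<in> A}"
proof -
  have "(T ^^ k) -` (A \<inter> (T ^^ k) ` B) \<inter> space M = {y \<in> B. (T ^^ k) y \<in> A}"
    using T_pow_bij[of k] sets.sets_into_space[OF assms(2)]
    by (auto simp: bij_betw_def dest: inj_onD)
  then show ?thesis
    using emeasure_T_pow[of "A \<inter> (T ^^ k) ` B" k] T_pow_image_sets[OF assms(2)] assms(1)
    by (simp add: measure_def)
qed

lemma AE_descendant:
  "AE y in M. \<forall>n k. \<forall>x<h n. y \<in> level (C n) x \<longrightarrow> (\<exists>d\<in>desc 0 n k. y \<in> level (C (n + k)) (x + d))"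
proof -
  have "AE y in M. x < h n \<longrightarrow> y \<in> level (C n) x \<longrightarrow> (\<exists>d\<in>desc 0 n k. y \<in> level (C (n + k)) (x + d))"
    for n k x
    using AE_not_in[OF level_desc_null[of x n k]] unfolding AE_M_iff
    by (cases "x < h n") (auto elim: eventually_mono)
  then show ?thesis
    by (simp add: AE_all_countable)
qed

lemma column_map_level:
  assumes "Suc i < h n" "y \<in> level (C n) i"
  shows "column_map (C n) y = Some (y + (bases (C n) ! Suc i - bases (C n) ! i))"
proof -
  have "(THE i. Suc i < h n \<and> y \<in> level (C n) i) = i"
    using assms level_disjoint[of _ n i] Suc_lessD by (intro the_equality) blast+
  then show ?thesis
    using assms by (auto simp: column_map_def)
qed

text \<open>The limit fixes \<open>T y\<close> only through late columns. In such a column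
  \<open>y\<close> lies in a copy of its level, and the copy is translated by the same amount, so
  the formula holds in every column.\<close>

lemma AE_T_eq:
  "AE y in M. \<forall>n i. Suc i < h n \<longrightarrow> y \<in> level (C n) i \<longrightarrow>
     T y = y + (bases (C n) ! Suc i - bases (C n) ! i)"
proof -
  have "AE y in M. \<forall>\<^sub>F n in sequentially. column_map (C n) y = Some (T y)"
    using rank_one by (simp add: rank_one_def)
  with AE_descendant show ?thesis
  proof eventually_elim
    fix y
    assume desc: "\<forall>n k. \<forall>x<h n. y \<in> level (C n) x \<longrightarrow>
        (\<exists>d\<in>desc 0 n k. y \<in> level (C (n + k)) (x + d))"
      and ev: "\<forall>\<^sub>F n in sequentially. column_map (C n) y = Some (T y)"
    show "\<forall>n i. Suc i < h n \<longrightarrow> y \<in> level (C n) i \<longrightarrow>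
        T y = y + (bases (C n) ! Suc i - bases (C n) ! i)"
    proof (intro allI impI)
      fix n i assume i: "Suc i < h n" "y \<in> level (C n) i"
      obtain k where k: "column_map (C (n + k)) y = Some (T y)"
        using ev unfolding eventually_sequentially by (metis le_add2)
      obtain d where d: "d \<in> desc 0 n k" "y \<in> level (C (n + k)) (i + d)"
        using desc i Suc_lessD by blast
      obtain c where "\<And>x. x < h n \<Longrightarrow> bases (C (n + k)) ! (x + d) = bases (C n) ! x + c"
        using bases_desc[OF d(1)] by blast
      then have "bases (C (n + k)) ! (Suc i + d) - bases (C (n + k)) ! (i + d)
          = bases (C n) ! Suc i - bases (C n) ! i"
        using i(1) Suc_lessD[OF i(1)] by (simp only:)
      moreover have "Suc (i + d) < h (n + k)"
        using desc_le[OF d(1)] i(1) by simp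
      ultimately show "T y = y + (bases (C n) ! Suc i - bases (C n) ! i)"
        using column_map_level[OF _ d(2)] k by simp
    qed
  qed
qed

lemma level_shift:
  "y \<in> level (C n) i \<longleftrightarrow> y + (bases (C n) ! j - bases (C n) ! i) \<in> level (C n) j"
  by (auto simp: level_def)

lemma AE_T_pow_eq:
  assumes "i + k < h n"
  shows "AE y in M. y \<in> level (C n) i \<longrightarrow>
    (T ^^ k) y = y + (bases (C n) ! (i + k) - bases (C n) ! i)"
  using assms
proof (induction k arbitrary: i)
  case (Suc k)
  have "AE y in M. T y \<in> level (C n) (Suc i) \<longrightarrow>
      (T ^^ k) (T y) = T y + (bases (C n) ! (Suc i + k) - bases (C n) ! Suc i)"
    by (rule AE_T[OF Suc.IH]) (use Suc.prems in simp)
  with AE_T_eq show ?case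
  proof eventually_elim
    fix y
    assume *: "\<forall>n i. Suc i < h n \<longrightarrow> y \<in> level (C n) i \<longrightarrow>
        T y = y + (bases (C n) ! Suc i - bases (C n) ! i)"
      "T y \<in> level (C n) (Suc i) \<longrightarrow>
        (T ^^ k) (T y) = T y + (bases (C n) ! (Suc i + k) - bases (C n) ! Suc i)"
    show "y \<in> level (C n) i \<longrightarrow>
        (T ^^ Suc k) y = y + (bases (C n) ! (i + Suc k) - bases (C n) ! i)"
    proof
      assume y: "y \<in> level (C n) i"
      have Ty: "T y = y + (bases (C n) ! Suc i - bases (C n) ! i)"
        using *(1) y Suc.prems by auto
      then have "T y \<in> level (C n) (Suc i)"
        using y level_shift[of y n i "Suc i"] by simp
      with *(2) have "(T ^^ k) (T y) = T y + (bases (C n) ! (Suc i + k) - bases (C n) ! Suc i)"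
        by blast
      then show "(T ^^ Suc k) y = y + (bases (C n) ! (i + Suc k) - bases (C n) ! i)"
        using Ty by (simp add: funpow_swap1)
    qed
  qed
qed simp

section \<open>Correlations of subsets of levels as counts of copies\<close>

text \<open>If \<open>y\<close> lies in copy \<open>d\<close> of level \<open>x'\<close> and its
  \<open>k\<close>-th iterate in copy \<open>e\<close> of level \<open>x\<close>, then the heights
  must match, because the orbit climbs inside one column. Each admissible \<open>d\<close>
  contributes at most one level width.\<close>

lemma correlation_le:
  assumes "A \<in> sets M" "B \<in> sets M" "A \<subseteq> level (C m) x" "B \<subseteq> level (C m) x'"
    and x: "x < h m" "x' < h m"
    and inside: "\<And>d. d \<in> desc 0 m l \<Longrightarrow> x' + d + k < h (m + l)"
  shows "measure M (A \<inter> (T ^^ k) ` B)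
    \<le> w (m + l) * card {d \<in> desc 0 m l. \<exists>e\<in>desc 0 m l. x' + d + k = x + e}"
proof -
  let ?D = "desc 0 m l" and ?n = "m + l"
  let ?P = "{d \<in> ?D. \<exists>e\<in>?D. x' + d + k = x + e}"
  let ?Y = "{y \<in> B. (T ^^ k) y \<in> A}" and ?Z = "\<Union>d\<in>?P. level (C ?n) (x' + d)"
  have shift: "AE y in M. \<forall>d\<in>?D. y \<in> level (C ?n) (x' + d) \<longrightarrow> (T ^^ k) y \<in> level (C ?n) (x' + d + k)"
  proof (subst AE_finite_all, simp, intro ballI)
    fix d assume "d \<in> ?D"
    from AE_T_pow_eq[OF inside[OF this]]
    show "AE y in M. y \<in> level (C ?n) (x' + d) \<longrightarrow> (T ^^ k) y \<in> level (C ?n) (x' + d + k)"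
    proof eventually_elim
      case (elim y)
      then show ?case using level_shift[of y ?n "x' + d" "x' + d + k"] by simp
    qed
  qed
  have "AE y in M. y \<in> ?Y \<longrightarrow> y \<in> ?Z"
    using AE_descendant AE_T_pow[OF AE_descendant, of k] shift
  proof eventually_elim
    case (elim y)
    show ?case
    proof
      assume y: "y \<in> ?Y"
      obtain d where d: "d \<in> ?D" "y \<in> level (C ?n) (x' + d)"
        using elim(1) y assms(4) x by blast
      obtain e where e: "e \<in> ?D" "(T ^^ k) y \<in> level (C ?n) (x + e)"
        using elim(2) y assms(3) x by blast
      have "x' + d + k = x + e"
        using elim(3) d e level_disjoint[of "x' + d + k" ?n "x + e"] inside[OF d(1)] desc_le[OF e(1)] x
        by fastforce
      then show "y \<in> ?Z" using d e(1) by blast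
    qed
  qed
  moreover have "?Z \<in> sets M"
    using desc_le x level_subset_space[of _ ?n] unfolding sets_M_iff
    by (auto intro!: sets.finite_UN) (metis add_less_mono1 add.commute order_less_le_trans subsetD)
  ultimately have "emeasure M ?Y \<le> emeasure M ?Z"
    by (intro emeasure_mono_AE)
  also have "\<dots> = emeasure lborel ?Z"
    by (rule emeasure_M) fact
  also have "\<dots> = measure lborel ?Z"
    by (intro emeasure_eq_measure2 fmeasurable.finite_UN) auto
  finally have "measure M ?Y \<le> measure lborel ?Z"
    unfolding measure_def[of M] by (intro enn2real_leI measure_nonneg)
  also have "\<dots> \<le> (\<Sum>d\<in>?P. measure lborel (level (C ?n) (x' + d)))"
    by (intro measure_UNION_le) auto
  also have "\<dots> = w ?n * card ?P" by simp
  finally show ?thesis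
    using measure_Int_T_pow_image[OF assms(1,2)] by simp
qed

text \<open>When \<open>d\<close> and \<open>d + k\<close> are both heights of copies,
  \<open>T ^^ k\<close> translates the lower copy onto the upper one. Only points missing from
  \<open>F\<close> at either end are lost.\<close>

lemma correlation_ge:
  assumes F: "F \<in> sets M" and x: "x < h m" and D: "D \<subseteq> desc 0 m l"
    and inside: "\<And>d. d \<in> desc 0 m l \<Longrightarrow> x + d + k < h (m + l)"
  defines "A \<equiv> F \<inter> level (C m) x"
    and "f \<equiv> \<lambda>d. measure lborel (level (C (m + l)) (x + d) - F)"
  shows "(\<Sum>d | d \<in> D \<and> d + k \<in> D. w (m + l) - f d - f (d + k)) \<le> measure M (A \<inter> (T ^^ k) ` A)"
proof -
  let ?n = "m + l"
  let ?P = "{d \<in> D. d + k \<in> D}"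
  define c where "c d = bases (C ?n) ! (x + d + k) - bases (C ?n) ! (x + d)" for d
  define Z where "Z d = {y \<in> level (C ?n) (x + d). y \<in> F \<and> y + c d \<in> F}" for d
  have [measurable]: "F \<in> sets borel" using F by (simp add: sets_M_iff)
  have finP: "finite ?P" using D finite_subset by (auto intro: finite_subset[OF _ finite_desc])
  have AM: "A \<in> sets M"
    using F level_subset_space[OF x] by (auto simp: A_def sets_M_iff)
  have Z_borel [measurable]: "Z d \<in> sets borel" for d
    unfolding Z_def by measurable
  have Z_fm: "Z d \<in> fmeasurable lborel" for d
    by (rule fmeasurableI2[OF level_fmeasurable[of ?n "x + d"]]) (auto simp: Z_def)
  have Z_ge: "w ?n - f d - f (d + k) \<le> measure lborel (Z d)" for d
  proof -
    let ?L = "level (C ?n) (x + d) - F" and ?L' = "level (C ?n) (x + (d + k)) - F"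
    \<comment> \<open>The gap of \<open>F\<close> in the upper level, pulled back by the translation
      to the lower one.\<close>
    let ?S = "(+) (c d) -` ?L'"
    have L': "?L \<in> fmeasurable lborel" "?L' \<in> fmeasurable lborel"
      by (auto intro: fmeasurable_Diff)
    have "emeasure lborel ?L' = emeasure (distr lborel borel ((+) (c d))) ?L'"
      by (simp add: lborel_distr_plus)
    also have "\<dots> = emeasure lborel ?S"
      by (subst emeasure_distr) auto
    finally have S: "emeasure lborel ?L' = emeasure lborel ?S" .
    have "?S \<in> sets lborel"
      using measurable_sets[of "(+) (c d)" lborel borel ?L'] by auto
    with S L' have S': "?S \<in> fmeasurable lborel"
      by (simp add: fmeasurable_def)
    have "level (C ?n) (x + d) \<subseteq> Z d \<union> (?L \<union> ?S)"
      using level_shift[of _ ?n "x + d" "x + d + k"]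
      by (auto simp: Z_def c_def add.commute[of _ "bases _ ! _ - _"]) (simp_all add: add.assoc)
    then have "w ?n \<le> measure lborel (Z d \<union> (?L \<union> ?S))"
      unfolding measure_level[of ?n "x + d", symmetric]
      using Z_fm[of d] L'(1) S' by (intro measure_mono_fmeasurable) auto
    also have "\<dots> \<le> measure lborel (Z d) + measure lborel (?L \<union> ?S)"
      using Z_fm[of d] L'(1) S' by (intro measure_Un_le) auto
    also have "measure lborel (?L \<union> ?S) \<le> measure lborel ?L + measure lborel ?S"
      using L'(1) S' by (intro measure_Un_le) auto
    also have "measure lborel ?S = measure lborel ?L'"
      using S by (simp add: measure_def)
    finally show ?thesis
      by (simp add: f_def)
  qed
  have "(\<Sum>d\<in>?P. w ?n - f d - f (d + k)) \<le> (\<Sum>d\<in>?P. measure lborel (Z d))"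
    by (intro sum_mono Z_ge)
  also have "\<dots> = measure lborel (\<Union>d\<in>?P. Z d)"
  proof (rule measure_finite_Union[symmetric])
    show "disjoint_family_on Z ?P"
      unfolding disjoint_family_on_def
    proof (intro ballI impI)
      fix d e assume "d \<in> ?P" "e \<in> ?P" "d \<noteq> e"
      then show "Z d \<inter> Z e = {}"
        using level_disjoint[of "x + d" ?n "x + e"] inside[of d] inside[of e] D
        by (fastforce simp: Z_def)
    qed
  qed (use finP fmeasurableD2[OF Z_fm] in auto)
  also have "\<dots> = measure M (\<Union>d\<in>?P. Z d)"
  proof (rule measure_M[symmetric])
    show "(\<Union>d\<in>?P. Z d) \<in> sets M"
      using finP F by (auto simp: sets_M_iff Z_def[abs_def] intro!: sets.finite_UN)
  qed
  also have "\<dots> \<le> measure M {y \<in> A. (T ^^ k) y \<in> A}"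
  proof -
    let ?Y = "{y \<in> A. (T ^^ k) y \<in> A}"
    have Y_eq: "?Y = A \<inter> ((T ^^ k) -` A \<inter> space M)"
      using sets.sets_into_space[OF AM] by auto
    have Y: "?Y \<in> sets M"
      unfolding Y_eq using measurable_sets[OF T_pow_measurable AM] AM by auto
    have "AE y in M. \<forall>d\<in>?P. y \<in> level (C ?n) (x + d) \<longrightarrow> (T ^^ k) y = y + c d"
      using AE_T_pow_eq[OF inside] D finP unfolding c_def
      by (subst AE_finite_all) auto
    then have "AE y in M. y \<in> (\<Union>d\<in>?P. Z d) \<longrightarrow> y \<in> ?Y"
    proof eventually_elim
      case (elim y)
      show ?case
      proof
        assume "y \<in> (\<Union>d\<in>?P. Z d)"
        then obtain d where d: "d \<in> D" "d + k \<in> D" "y \<in> Z d" by blast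
        have "y + c d \<in> level (C ?n) (x + (d + k))"
          using d(3) level_shift[of y ?n "x + d" "x + d + k"] by (simp add: Z_def c_def add.assoc)
        then have "y \<in> A" "y + c d \<in> A"
          using d level_desc_subset[of d m l x] level_desc_subset[of "d + k" m l x] D x
          by (auto simp: A_def Z_def)
        moreover have "(T ^^ k) y = y + c d"
          using elim d by (auto simp: Z_def)
        ultimately show "y \<in> ?Y" by simp
      qed
    qed
    then have "emeasure M (\<Union>d\<in>?P. Z d) \<le> emeasure M ?Y"
      using Y by (intro emeasure_mono_AE)
    moreover have "emeasure M ?Y < \<infinity>"
    proof -
      have "emeasure M ?Y \<le> emeasure lborel (level (C m) x)"
        unfolding emeasure_M[OF Y] by (intro emeasure_mono) (auto simp: A_def)
      also have "\<dots> < \<infinity>"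
        using level_fmeasurable[of m x] by (auto simp: fmeasurable_def)
      finally show ?thesis .
    qed
    ultimately show ?thesis
      unfolding measure_def by (intro enn2real_mono) (auto simp: less_top)
  qed
  also have "\<dots> = measure M (A \<inter> (T ^^ k) ` A)"
    using measure_Int_T_pow_image[OF AM AM] by simp
  finally show ?thesis by simp
qed

section \<open>Decoding differences of heights\<close>

text \<open>Four times \<open>offset n c\<close> already exceeds or equals both offsets on the left,
  and \<open>offset n b\<close> is at least \<open>offset n 2 = 2 * h n + 1\<close>, which supplies
  the gap.\<close>

lemma offset_sum_gap:
  assumes "2 \<le> e" "e \<le> c" "c < a" "a < r n" "2 \<le> b" "b < r n"
  shows "offset n c + offset n e + 2 * h n \<le> offset n a + offset n b"
proof -
  have "offset n e \<le> offset n c"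
    using offset_mono[of e c n] assms by (cases "e = c") auto
  moreover have "offset n 2 \<le> offset n b"
    using offset_mono[of 2 b n] assms by (cases "b = 2") auto
  moreover have "4 * offset n c \<le> offset n a"
    using offset_steep_less[of c a n] assms by simp
  ultimately show ?thesis
    by (simp add: offset_2)
qed

lemma offset_sum_gap':
  assumes "2 \<le> e" "e < b" "b < r n"
  shows "offset n e + 2 * h n \<le> offset n b"
proof -
  have "offset n 2 \<le> offset n e"
    using offset_mono[of 2 e n] assms by (cases "e = 2") auto
  then show ?thesis
    using offset_steep_less[of e b n] assms by (simp add: offset_2)
qed

text \<open>A Sidon property that tolerates errors below \<open>2 * h n\<close>: different larger
  indices would create too large a gap, and then so would different smaller ones.\<close>

lemma offset_sum_unique_ordered:
  assumes "2 \<le> b" "b \<le> a" "a < r n" "2 \<le> e" "e \<le> c" "c < r n"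
    and "offset n a + offset n b < offset n c + offset n e + 2 * h n"
      "offset n c + offset n e < offset n a + offset n b + 2 * h n"
  shows "offset n a + offset n b = offset n c + offset n e"
proof -
  have "a = c"
    using offset_sum_gap[of e c a n b] offset_sum_gap[of b a c n e] assms by linarith
  moreover have "b = e"
    using offset_sum_gap'[of e b n] offset_sum_gap'[of b e n] assms \<open>a = c\<close>
    by (cases b e rule: linorder_cases) auto
  ultimately show ?thesis by simp
qed

lemma offset_sum_unique:
  assumes "a \<in> {2..<r n}" "b \<in> {2..<r n}" "c \<in> {2..<r n}" "e \<in> {2..<r n}"
    and "offset n a + offset n b + t = offset n c + offset n e + u" "t < 2 * h n" "u < 2 * h n"
  shows "offset n a + offset n b = offset n c + offset n e"
  using offset_sum_unique_ordered[of a b n c e] offset_sum_unique_ordered[of a b n e c]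
    offset_sum_unique_ordered[of b a n c e] offset_sum_unique_ordered[of b a n e c] assms
  by (cases "a \<le> b"; cases "c \<le> e") auto

text \<open>The hypothesis says that a time between two copies of one level is also a time from a
  copy of \<open>x'\<close> to a copy of \<open>x\<close>, written without subtraction. At the
  outermost stage the offsets must cancel, since the remainders stay below twice the height;
  induction strips one stage at a time until only \<open>x = x'\<close> is left.\<close>

lemma desc_diff_decode:
  assumes "x < h m" "x' < h m"
    and "d \<in> desc 2 m k" "d' \<in> desc 2 m k" "e \<in> desc 2 m k" "e' \<in> desc 2 m k"
    and "d + e' + x' = e + d' + x"
  shows "x = x'"
  using assms(3-)
proof (induction k arbitrary: d d' e e')
  case (Suc k)
  let ?o = "offset (m + k)"
  obtain a d1 where d: "a \<in> {2..<r (m + k)}" "d1 \<in> desc 2 m k" "d = ?o a + d1"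
    using Suc.prems(1) by (auto simp: desc.simps)
  obtain a' d1' where d': "a' \<in> {2..<r (m + k)}" "d1' \<in> desc 2 m k" "d' = ?o a' + d1'"
    using Suc.prems(2) by (auto simp: desc.simps)
  obtain b e1 where e: "b \<in> {2..<r (m + k)}" "e1 \<in> desc 2 m k" "e = ?o b + e1"
    using Suc.prems(3) by (auto simp: desc.simps)
  obtain b' e1' where e': "b' \<in> {2..<r (m + k)}" "e1' \<in> desc 2 m k" "e' = ?o b' + e1'"
    using Suc.prems(4) by (auto simp: desc.simps)
  have eq: "?o a + ?o b' + (d1 + e1' + x') = ?o b + ?o a' + (e1 + d1' + x)"
    using Suc.prems(5) d(3) d'(3) e(3) e'(3) by simp
  have "?o a + ?o b' = ?o b + ?o a'"
    using desc_le[OF d(2)] desc_le[OF d'(2)] desc_le[OF e(2)] desc_le[OF e'(2)] assms(1,2)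
    by (intro offset_sum_unique[OF d(1) e'(1) e(1) d'(1) eq]) auto
  then show ?case
    using Suc.IH[OF d(2) d'(2) e(2) e'(2)] eq by simp
qed simp

section \<open>Levels almost filled by a given set\<close>

lemma width_le: "w n \<le> (1 / 2) ^ n"
proof (induction n)
  case 0
  then show ?case by (simp add: C_0)
next
  case (Suc n)
  have "w n / real (r n) \<le> w n / 2"
    using r_ge3[of n] width_pos[of n] by (intro divide_left_mono) auto
  then show ?case
    using Suc by (simp add: width_Suc)
qed

lemma width_tendsto_0: "w \<longlonglongrightarrow> 0"
proof (rule tendsto_sandwich[of "\<lambda>_. 0" _ _ "\<lambda>n. (1 / 2) ^ n"])
  show "(\<lambda>n. (1 / 2) ^ n) \<longlonglongrightarrow> (0::real)" by (rule LIMSEQ_power_zero) simp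
qed (use width_le width_pos in \<open>auto intro!: always_eventually less_imp_le\<close>)

text \<open>
  Levels inside an open set that is only slightly larger than \<open>F\<close> exhaust \<open>F\<close>, so their average
  density is close to one. Since single levels become small, more than one of them is dense.
\<close>

lemma two_dense_levels:
  assumes F: "F \<in> sets M" "0 < emeasure M F" "emeasure M F < \<infinity>" and "0 < \<epsilon>"
  shows "\<exists>m\<ge>m0. \<exists>x x'. x < h m \<and> x' < h m \<and> x \<noteq> x' \<and>
    measure lborel (level (C m) x - F) \<le> \<epsilon> * w m \<and> measure lborel (level (C m) x' - F) \<le> \<epsilon> * w m"
proof -
  define \<mu> where "\<mu> = measure lborel F"
  have F_borel [measurable]: "F \<in> sets borel" and F_space: "F \<subseteq> space M"
    using F by (auto simp: sets_M_iff)
  have F_fm: "F \<in> fmeasurable lborel"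
    using F by (simp add: fmeasurable_def emeasure_M)
  have \<mu>: "0 < \<mu>"
    using F(1,2) emeasure_eq_measure2[OF F_fm] by (simp add: emeasure_M \<mu>_def)
  obtain U where U: "open U" "F \<subseteq> U" "emeasure lborel (U - F) < ennreal (\<epsilon> * \<mu> / 4)"
    using outer_regular_lborel[OF F_borel, of "\<epsilon> * \<mu> / 4"] \<mu> \<open>0 < \<epsilon>\<close> by auto
  have U_borel [measurable]: "U \<in> sets borel" using U(1) by simp
  have UF_fm: "U - F \<in> fmeasurable lborel"
    using U(3) less_trans[OF U(3) ennreal_less_top] by (simp add: fmeasurable_def)
  have UF: "measure lborel (U - F) < \<epsilon> * \<mu> / 4"
    using U(3) emeasure_eq_measure2[OF UF_fm] by (simp add: ennreal_less_iff)
  \<comment> \<open>\<open>V m\<close> is covered by the levels inside \<open>U\<close>.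
    \<open>W m\<close> keeps the points that stay covered from stage \<open>m\<close> on, which
    makes the sequence increasing and gives convergence of measures.\<close>
  define G where "G m = {x. x < h m \<and> level (C m) x \<subseteq> U}" for m
  define V where "V m = (\<Union>x\<in>G m. level (C m) x)" for m
  define W where "W m = (\<Inter>k\<in>{m..}. V k)" for m
  have finG: "finite (G m)" for m by (simp add: G_def)
  have V_borel [measurable]: "V m \<in> sets borel" for m
    unfolding V_def by (intro sets.finite_UN finG) simp
  have W_borel [measurable]: "W m \<in> sets borel" for m
    unfolding W_def by (intro sets.countable_INT') auto
  have V_fm: "V m \<in> fmeasurable lborel" for m
    unfolding V_def by (intro fmeasurable.finite_UN finG) simp
  \<comment> \<open>The levels around a point of \<open>F\<close> shrink, so eventually they fit
    into a ball inside \<open>U\<close>.\<close>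
  have "AE y in lborel. y \<in> F \<longrightarrow> y \<in> (\<Union>m. F \<inter> W m)"
    using AE_descendant[unfolded AE_M_iff]
  proof eventually_elim
    case (elim y)
    show ?case
    proof
      assume y: "y \<in> F"
      then obtain n i where ni: "i < h n" "y \<in> level (C n) i"
        using F_space unfolding space_M levels_def by blast
      obtain \<delta> where \<delta>: "0 < \<delta>" "ball y \<delta> \<subseteq> U"
        using U y open_contains_ball by (metis subsetD)
      have "\<forall>\<^sub>F k in sequentially. w k < \<delta>"
        using width_tendsto_0 \<delta>(1) by (rule order_tendstoD)
      then obtain k0 where k0: "\<And>k. k \<ge> k0 \<Longrightarrow> w k < \<delta>"
        by (auto simp: eventually_sequentially)
      have V: "y \<in> V k" if "k \<ge> max n k0" for k
      proof -
        obtain l where l: "k = n + l" using \<open>k \<ge> max n k0\<close> by (metis max.bounded_iff nat_le_iff_add)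
        obtain d where d: "d \<in> desc 0 n l" "y \<in> level (C k) (i + d)"
          using elim ni y F_space unfolding l by blast
        have "level (C k) (i + d) \<subseteq> ball y \<delta>"
          using d(2) k0[of k] that by (auto simp: level_def dist_real_def)
        then have "i + d \<in> G k"
          using \<delta>(2) desc_le[OF d(1)] ni(1) l by (auto simp: G_def)
        then show ?thesis
          using d(2) by (auto simp: V_def)
      qed
      then show "y \<in> (\<Union>m. F \<inter> W m)"
        using y V by (auto simp: W_def intro!: exI[of _ "max n k0"])
    qed
  qed
  then have "emeasure lborel (\<Union>m. F \<inter> W m) = emeasure lborel F"
    by (intro emeasure_eq_AE) auto
  then have union: "emeasure lborel (\<Union>m. F \<inter> W m) \<noteq> \<infinity>" "measure lborel (\<Union>m. F \<inter> W m) = \<mu>"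
    using fmeasurableD2[OF F_fm] by (auto simp: measure_def \<mu>_def)
  have "(\<lambda>m. measure lborel (F \<inter> W m)) \<longlonglongrightarrow> measure lborel (\<Union>m. F \<inter> W m)"
    by (rule Lim_measure_incseq) (use union(1) in \<open>auto simp: incseq_def W_def\<close>)
  then have "\<forall>\<^sub>F m in sequentially. 3 / 4 * \<mu> < measure lborel (F \<inter> W m)"
    using \<mu> unfolding union(2) by (intro order_tendstoD) auto
  moreover have "\<forall>\<^sub>F m in sequentially. w m < \<mu> / 4"
    using width_tendsto_0 \<mu> by (intro order_tendstoD) auto
  ultimately have "\<forall>\<^sub>F m in sequentially. m \<ge> m0 \<and> 3 / 4 * \<mu> < measure lborel (F \<inter> W m) \<and> w m < \<mu> / 4"
    using eventually_ge_at_top[of m0] by eventually_elim auto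
  then obtain m where m: "m \<ge> m0" "3 / 4 * \<mu> < measure lborel (F \<inter> W m)" "w m < \<mu> / 4"
    by (auto simp: eventually_sequentially)
  let ?L = "level (C m)"
  let ?B = "{x \<in> G m. measure lborel (?L x - F) \<le> \<epsilon> * w m}"
  have disj: "disjoint_family_on ?L (G m)"
    using level_disjoint by (auto simp: disjoint_family_on_def G_def)
  have "measure lborel (F \<inter> W m) \<le> measure lborel (V m)"
    by (intro measure_mono_fmeasurable V_fm) (auto simp: W_def)
  also have "\<dots> \<le> (\<Sum>x\<in>G m. measure lborel (?L x))"
    unfolding V_def by (intro measure_UNION_le finG) auto
  finally have many: "3 / 4 * \<mu> < card (G m) * w m"
    using m(2) by simp
  have "(\<Sum>x\<in>G m. measure lborel (?L x - F)) = measure lborel (\<Union>x\<in>G m. ?L x - F)"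
  proof (rule measure_finite_Union[symmetric, OF finG])
    show "disjoint_family_on (\<lambda>x. ?L x - F) (G m)"
      using disj unfolding disjoint_family_on_def by blast
    show "emeasure lborel (?L x - F) \<noteq> \<infinity>" if "x \<in> G m" for x
      using fmeasurableD2[OF fmeasurable_Diff[OF level_fmeasurable]] by simp
  qed auto
  also have "\<dots> \<le> measure lborel (U - F)"
    by (intro measure_mono_fmeasurable UF_fm sets.finite_UN finG) (auto simp: G_def)
  finally have few: "(\<Sum>x\<in>G m. measure lborel (?L x - F)) < \<epsilon> * \<mu> / 4"
    using UF by simp
  \<comment> \<open>Discarding one level leaves total width above \<open>\<mu> / 2\<close>. If all
    the remaining levels were not dense, they would miss at least
    \<open>\<epsilon> * \<mu> / 2\<close> of \<open>F\<close>, above the available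
    \<open>\<epsilon> * \<mu> / 4\<close>.\<close>
  have "\<not> card ?B \<le> 1"
  proof
    assume B: "card ?B \<le> 1"
    have "real (card (G m)) - 1 \<le> card (G m - ?B)"
      using B finG[of m] card_mono[of "G m" ?B] by (subst card_Diff_subset) auto
    then have "(real (card (G m)) - 1) * (\<epsilon> * w m) \<le> card (G m - ?B) * (\<epsilon> * w m)"
      using \<open>0 < \<epsilon>\<close> width_pos[of m] by (intro mult_right_mono) auto
    also have "\<dots> = (\<Sum>x\<in>G m - ?B. \<epsilon> * w m)" by simp
    also have "\<dots> \<le> (\<Sum>x\<in>G m - ?B. measure lborel (?L x - F))"
      by (intro sum_mono) auto
    also have "\<dots> \<le> (\<Sum>x\<in>G m. measure lborel (?L x - F))"
      by (intro sum_mono2 finG) auto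
    also have "\<dots> < \<epsilon> * (\<mu> / 4)" using few by simp
    finally have "\<epsilon> * ((real (card (G m)) - 1) * w m) < \<epsilon> * (\<mu> / 4)"
      by (simp only: mult.left_commute)
    then have "(real (card (G m)) - 1) * w m < \<mu> / 4"
      using \<open>0 < \<epsilon>\<close> by (simp only: mult_less_cancel_left_pos)
    then show False
      using many m(3) \<mu> by (simp add: left_diff_distrib)
  qed
  then obtain x x' where "x \<in> ?B" "x' \<in> ?B" "x \<noteq> x'"
    using card_le_Suc0_iff_eq[of ?B] finG[of m] by auto
  then show ?thesis
    using m(1) by (auto simp: G_def)
qed

lemma measure_dense:
  assumes "F \<in> sets M" "x < h m" "measure lborel (level (C m) x - F) \<le> \<epsilon> * w m"
  shows "(1 - \<epsilon>) * w m \<le> measure M (F \<inter> level (C m) x)" "measure M (F \<inter> level (C m) x) \<le> w m"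
proof -
  let ?L = "level (C m) x"
  have F: "F \<in> sets borel" using assms(1) by (simp add: sets_M_iff)
  have "measure M (F \<inter> ?L) = measure lborel (F \<inter> ?L)"
    using assms(1) F by (intro measure_M) (auto simp: sets_M_iff)
  moreover have "measure lborel ?L \<le> measure lborel (F \<inter> ?L) + measure lborel (?L - F)"
    by (rule order_trans[OF measure_mono_fmeasurable measure_Un_le])
      (use F in \<open>auto intro!: fmeasurable.Un fmeasurable_Diff fmeasurableI2[OF level_fmeasurable]\<close>)
  moreover have "measure lborel (F \<inter> ?L) \<le> measure lborel ?L"
    using F by (intro measure_mono_fmeasurable) auto
  ultimately show "(1 - \<epsilon>) * w m \<le> measure M (F \<inter> ?L)" "measure M (F \<inter> ?L) \<le> w m"
    using assms(3) by (auto simp: algebra_simps)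
qed

section \<open>Decodable return times and the contradiction\<close>

text \<open>The proportion of copies avoiding the first two subcolumns is the product of
  \<open>1 - 2 / r\<close>, which is at least one minus the sum. This is where the summability
  enters.\<close>

lemma card_desc_2_ge:
  assumes "(\<Sum>i<k. 2 / real (r (m + i))) \<le> \<delta>"
  shows "(1 - \<delta>) * card (desc 0 m k) \<le> card (desc 2 m k)"
proof -
  have "1 - \<delta> \<le> (\<Prod>i<k. 1 - 2 / real (r (m + i)))"
    using r_ge3 assms
    by (intro order_trans[OF _ Weierstrass_prod_ineq]) (auto simp: divide_le_eq intro: order_trans[of _ 3])
  also have "\<dots> = (\<Prod>i<k. real (r (m + i) - 2) / real (r (m + i)))"
  proof (intro prod.cong refl)
    fix i show "1 - 2 / real (r (m + i)) = real (r (m + i) - 2) / real (r (m + i))"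
      using r_ge3[of "m + i"] by (simp add: of_nat_diff field_simps)
  qed
  also have "\<dots> = card (desc 2 m k) / card (desc 0 m k)"
    by (simp add: card_desc prod_dividef)
  finally show ?thesis
    using width_card_desc[of m k] width_pos[of m] by (cases "card (desc 0 m k) = 0") (auto simp: field_simps)
qed

lemma a_coeff_pos:
  assumes "F \<in> sets M" "0 < emeasure M F" "emeasure M F < \<infinity>" "0 < N"
  shows "0 < a_coeff M T F N"
proof -
  have F: "0 < measure M F"
    using assms(2,3) by (simp add: measure_def enn2real_positive_iff)
  have "u_coeff M T F 0 \<le> a_coeff M T F N"
    unfolding a_coeff_def using \<open>0 < N\<close> by (intro member_le_sum) (auto simp: u_coeff_def)
  moreover have "0 < u_coeff M T F 0"
    using F by (simp add: u_coeff_def)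
  ultimately show ?thesis by simp
qed

text \<open>
  The two sums are over the same times \<open>K\<close>, the differences of heights that avoid the first two
  subcolumns: the first one is a positive fraction of the largest possible value, the second one
  only sees pairs of heights that meet the first two subcolumns.
\<close>

lemma correlations_separate:
  fixes F x x' m k
  defines "A \<equiv> F \<inter> level (C m) x" and "B \<equiv> F \<inter> level (C m) x'"
    and "N \<equiv> h (m + Suc k) div 2" and "Q \<equiv> w m * card (desc 0 m (Suc k))"
  assumes F: "F \<in> sets M" and x: "x < h m" "x' < h m" "x \<noteq> x'"
    and dense: "measure lborel (level (C m) x - F) \<le> w m / 20"
    and tail: "(\<Sum>i<Suc k. 2 / real (r (m + i))) \<le> 1 / 40"
  obtains K where "K \<subseteq> {..<N}"
    "(\<Sum>j<N. measure M (A \<inter> (T ^^ j) ` A)) \<le> Q"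
    "3 / 8 * Q \<le> (\<Sum>j\<in>K. measure M (A \<inter> (T ^^ j) ` A))"
    "(\<Sum>j\<in>K. measure M (A \<inter> (T ^^ j) ` B)) \<le> Q / 20"
proof -
  let ?l = "Suc k"
  let ?n = "m + ?l" and ?E = "desc 0 m ?l" and ?G = "desc 2 m ?l"
  define f where "f d = measure lborel (level (C ?n) (x + d) - F)" for d
  define K where "K = {j. j < N \<and> (\<exists>d\<in>?G. d + j \<in> ?G)}"
  have finK: "finite K" by (simp add: K_def)
  have GE: "?G \<subseteq> ?E" by (rule desc_mono)
  have F_borel [measurable]: "F \<in> sets borel" using F by (simp add: sets_M_iff)
  have AB: "A \<in> sets M" "B \<in> sets M" "A \<subseteq> level (C m) x" "B \<subseteq> level (C m) x'"
    using F by (auto simp: A_def B_def sets_M_iff)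
  \<comment> \<open>Copies lie in the lower half of the column and \<open>N\<close> is half its
    height, so the orbits do not leave it.\<close>
  have inside: "y + d + j < h ?n" if "y < h m" "d \<in> ?E" "j < N" for y d j
    using desc_le_half[OF that(2)] that(1,3) unfolding N_def by linarith
  have wQ: "w ?n * (real (card ?E))\<^sup>2 = Q"
    using width_card_desc[of m ?l] by (simp add: Q_def power2_eq_square flip: mult.assoc)
  have "(39 / 40 * real (card ?E))\<^sup>2 \<le> (real (card ?G))\<^sup>2"
    using card_desc_2_ge[OF tail] by (intro power_mono) auto
  then have "1521 / 1600 * (real (card ?E))\<^sup>2 \<le> (real (card ?G))\<^sup>2"
    by (simp add: power_mult_distrib power_divide)
  \<comment> \<open>\<open>1521 / 1600\<close> is just above
    \<open>19 / 20 = 1520 / 1600\<close>.\<close>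
  then have G_ge: "19 / 20 * (real (card ?E))\<^sup>2 \<le> (real (card ?G))\<^sup>2"
    using zero_le_power2[of "real (card ?E)"] by linarith
  have "(\<Sum>j<N. measure M (A \<inter> (T ^^ j) ` A))
      \<le> (\<Sum>j<N. w ?n * card {d \<in> ?E. \<exists>e\<in>?E. x + d + j = x + e})"
    using AB x inside by (intro sum_mono correlation_le) auto
  also have "\<dots> = w ?n * real (\<Sum>j<N. card {d \<in> ?E. \<exists>e\<in>?E. x + d + j = x + e})"
    by (simp only: sum_distrib_left of_nat_sum)
  also have "\<dots> \<le> w ?n * real (card (?E \<times> ?E))"
    using width_pos[of ?n] by (intro mult_left_mono of_nat_mono sum_card_shift_le) auto
  also have "\<dots> = Q"
    using wQ by (simp add: card_cartesian_product power2_eq_square)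
  finally have upper: "(\<Sum>j<N. measure M (A \<inter> (T ^^ j) ` A)) \<le> Q" .
  have "(\<Sum>j\<in>K. measure M (A \<inter> (T ^^ j) ` B))
      \<le> (\<Sum>j\<in>K. w ?n * card {d \<in> ?E. \<exists>e\<in>?E. x' + d + j = x + e})"
    using AB x inside by (intro sum_mono correlation_le) (auto simp: K_def)
  also have "\<dots> = w ?n * real (\<Sum>j\<in>K. card {d \<in> ?E. \<exists>e\<in>?E. x' + d + j = x + e})"
    by (simp only: sum_distrib_left of_nat_sum)
  also have "\<dots> \<le> w ?n * real (card (?E \<times> ?E - ?G \<times> ?G))"
  proof (intro mult_left_mono of_nat_mono sum_card_shift_le finK)
    fix j d e assume *: "j \<in> K" "d \<in> ?E" "e \<in> ?E" "x' + d + j = x + e"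
    obtain d' where d': "d' \<in> ?G" "d' + j \<in> ?G"
      using *(1) by (auto simp: K_def)
    \<comment> \<open>The time \<open>j\<close> is also the difference of \<open>d' + j\<close> and
      \<open>d'\<close>, so two decodable heights would force \<open>x = x'\<close>.\<close>
    have "\<not> (d \<in> ?G \<and> e \<in> ?G)"
      using desc_diff_decode[OF x(1,2) d'(2,1), of e d] *(4) x(3) by auto
    then show "(d, e) \<in> ?E \<times> ?E - ?G \<times> ?G"
      using *(2,3) by blast
  qed (use width_pos[of ?n] in \<open>auto\<close>)
  also have "real (card (?E \<times> ?E - ?G \<times> ?G)) = (card ?E)\<^sup>2 - (real (card ?G))\<^sup>2"
    using GE card_mono[OF finite_desc GE]
    by (subst card_Diff_subset)
      (auto simp: card_cartesian_product power2_eq_square of_nat_diff mult_mono)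
  also have "w ?n * \<dots> \<le> w ?n * ((real (card ?E))\<^sup>2 / 20)"
    using G_ge width_pos[of ?n] by (intro mult_left_mono) auto
  finally have off: "(\<Sum>j\<in>K. measure M (A \<inter> (T ^^ j) ` B)) \<le> Q / 20"
    using wQ by simp
  have "sum f ?E = measure lborel (\<Union>d\<in>?E. level (C ?n) (x + d) - F)"
    unfolding f_def
  proof (rule measure_finite_Union[symmetric, OF finite_desc])
    show "disjoint_family_on (\<lambda>d. level (C ?n) (x + d) - F) ?E"
      unfolding disjoint_family_on_def
    proof (intro ballI impI)
      fix d e assume "d \<in> ?E" "e \<in> ?E" "d \<noteq> e"
      then show "(level (C ?n) (x + d) - F) \<inter> (level (C ?n) (x + e) - F) = {}"
        using level_disjoint[of "x + d" ?n "x + e"] desc_le[of d 0 m ?l] desc_le[of e 0 m ?l] x(1)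
        by auto
    qed
    show "emeasure lborel (level (C ?n) (x + d) - F) \<noteq> \<infinity>" for d
      using fmeasurableD2[OF fmeasurable_Diff[OF level_fmeasurable]] by simp
  qed auto
  also have "\<dots> \<le> measure lborel (level (C m) x - F)"
    using level_desc_subset[OF _ x(1), of _ ?l]
    by (intro measure_mono_fmeasurable fmeasurable_Diff level_fmeasurable sets.finite_UN finite_desc)
      auto
  finally have "sum f ?E \<le> w m / 20" using dense by simp
  then have fG: "sum f ?G \<le> w m / 20"
    using sum_mono2[OF finite_desc GE, of f] by (simp add: f_def)
  have "card ?G * sum f ?G \<le> card ?E * (w m / 20)"
    using fG card_mono[OF finite_desc GE] by (intro mult_mono) (auto simp: f_def sum_nonneg)
  then have "2 * card ?G * sum f ?G \<le> Q / 10"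
    by (simp add: Q_def mult_ac)
  moreover have "w ?n * (19 / 20 * (real (card ?E))\<^sup>2) \<le> w ?n * (real (card ?G))\<^sup>2"
    using G_ge width_pos[of ?n] by (intro mult_left_mono) auto
  \<comment> \<open>Half of the \<open>19 / 20\<close> share of pairs, minus the loss
    \<open>Q / 10\<close>: \<open>19 / 40 - 4 / 40 = 3 / 8\<close>.\<close>
  ultimately have "3 / 8 * Q \<le> w ?n * (card ?G)\<^sup>2 / 2 - 2 * card ?G * sum f ?G"
    using wQ by simp
  also have "\<dots> \<le> (\<Sum>j\<in>K. \<Sum>d | d \<in> ?G \<and> d + j \<in> ?G. w ?n - f d - f (d + j))"
    unfolding K_def
  proof (rule sum_ordered_pairs_ge)
    have "d < N" if "d \<in> ?G" for d
      using desc_le_half[OF that] x(1) unfolding N_def by linarith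
    then show "?G \<subseteq> {..<N}" by blast
  qed (use width_pos[of ?n] in \<open>auto simp: f_def\<close>)
  also have "\<dots> \<le> (\<Sum>j\<in>K. measure M (A \<inter> (T ^^ j) ` A))"
    unfolding f_def A_def using F x GE inside
    by (intro sum_mono correlation_ge) (auto simp: K_def)
  finally show thesis
    using that[of K] upper off by (auto simp: K_def)
qed

lemma not_rationally_weakly_mixing:
  assumes summable: "summable (\<lambda>n. 1 / real (r n))"
  shows "\<not> rationally_weakly_mixing M T"
proof
  assume "rationally_weakly_mixing M T"
  then obtain F where F: "F \<in> sets M" "0 < emeasure M F" "emeasure M F < \<infinity>"
    and mixing: "\<forall>A\<in>sets M. \<forall>B\<in>sets M. A \<subseteq> F \<longrightarrow> B \<subseteq> F \<longrightarrow>
      (\<lambda>n. 1 / a_coeff M T F n * (\<Sum>k<n. \<bar>measure M (A \<inter> (T ^^ k) ` B) -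
        measure M A * measure M B * u_coeff M T F k\<bar>)) \<longlonglongrightarrow> 0"
    unfolding rationally_weakly_mixing_def by (elim bexE conjE) (rule that)
  have summable2: "summable (\<lambda>n. 2 / real (r n))"
    using summable_mult[OF summable, of 2] by simp
  obtain m0 where m0: "\<And>n. n \<ge> m0 \<Longrightarrow> norm (\<Sum>i. 2 / real (r (i + n))) < 1 / 40"
    using suminf_exist_split[OF _ summable2, of "1 / 40"] by auto
  obtain m x x' where m: "m \<ge> m0" and x: "x < h m" "x' < h m" "x \<noteq> x'"
    and dense: "measure lborel (level (C m) x - F) \<le> 1 / 20 * w m"
      "measure lborel (level (C m) x' - F) \<le> 1 / 20 * w m"
    using two_dense_levels[OF F, of "1 / 20" m0] by auto
  have tail: "(\<Sum>i<k. 2 / real (r (m + i))) \<le> 1 / 40" for k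
    using sum_le_suminf[OF summable_ignore_initial_segment[OF summable2, of m], of "{..<k}"] m0[OF m]
    by (simp add: add.commute)
  define A where "A = F \<inter> level (C m) x"
  define B where "B = F \<inter> level (C m) x'"
  define u where "u = u_coeff M T F"
  define \<eta> where "\<eta> = (w m)\<^sup>2 / 20"
  have AB: "A \<in> sets M" "B \<in> sets M" "A \<subseteq> F" "B \<subseteq> F"
    using F by (auto simp: A_def B_def sets_M_iff)
  have \<mu>A: "19 / 20 * w m \<le> measure M A" "measure M A \<le> w m"
    and \<mu>B: "19 / 20 * w m \<le> measure M B" "measure M B \<le> w m"
    using measure_dense[OF F(1) x(1) dense(1)] measure_dense[OF F(1) x(2) dense(2)]
    by (simp_all add: A_def B_def)
  have small: "\<forall>\<^sub>F n in sequentially. (\<Sum>k<n. \<bar>measure M (A \<inter> (T ^^ k) ` D) -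
        measure M A * measure M D * u k\<bar>) \<le> \<eta> * a_coeff M T F n" if "D \<in> {A, B}" for D
  proof -
    have "\<forall>\<^sub>F n in sequentially. 1 / a_coeff M T F n * (\<Sum>k<n. \<bar>measure M (A \<inter> (T ^^ k) ` D) -
        measure M A * measure M D * u k\<bar>) < \<eta>"
      unfolding u_def using that AB width_pos[of m]
      by (intro order_tendstoD(2)[OF mixing[rule_format]]) (auto simp: \<eta>_def)
    with eventually_gt_at_top[of 0] show ?thesis
    proof eventually_elim
      case (elim n)
      then show ?case
        using a_coeff_pos[OF F, of n] by (simp add: field_simps)
    qed
  qed
  obtain N0 where N0: "\<And>n D. n \<ge> N0 \<Longrightarrow> D \<in> {A, B} \<Longrightarrow>
      (\<Sum>k<n. \<bar>measure M (A \<inter> (T ^^ k) ` D) - measure M A * measure M D * u k\<bar>)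
        \<le> \<eta> * a_coeff M T F n"
  proof -
    have "\<forall>\<^sub>F n in sequentially. \<forall>D\<in>{A, B}.
      (\<Sum>k<n. \<bar>measure M (A \<inter> (T ^^ k) ` D) - measure M A * measure M D * u k\<bar>)
        \<le> \<eta> * a_coeff M T F n"
      by (rule eventually_ball_finite) (use small in auto)
    then show thesis
      using that unfolding eventually_sequentially by blast
  qed
  \<comment> \<open>With \<open>m\<close> fixed, this \<open>k\<close> makes the column so high that
    half its height reaches \<open>N0\<close>.\<close>
  define k where "k = 2 * N0"
  define N where "N = h (m + Suc k) div 2"
  define Q where "Q = w m * card (desc 0 m (Suc k))"
  have "N0 \<le> N"
    using height_ge[of "m + Suc k"] by (simp add: N_def k_def)
  note close = N0[OF this]
  have "card (desc 0 m (Suc k)) \<noteq> 0"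
    using width_card_desc[of m "Suc k"] width_pos[of m] by (metis mult_zero_right of_nat_0 less_irrefl)
  then have Q: "0 < Q"
    unfolding Q_def using width_pos[of m] by (intro mult_pos_pos) linarith+
  obtain K where K: "K \<subseteq> {..<N}"
    "(\<Sum>j<N. measure M (A \<inter> (T ^^ j) ` A)) \<le> Q"
    "3 / 8 * Q \<le> (\<Sum>j\<in>K. measure M (A \<inter> (T ^^ j) ` A))"
    "(\<Sum>j\<in>K. measure M (A \<inter> (T ^^ j) ` B)) \<le> Q / 20"
    using correlations_separate[OF F(1) x _ tail[of "Suc k"]] dense(1)
    unfolding A_def B_def N_def Q_def by auto
  define \<alpha> where "\<alpha> = a_coeff M T F N"
  define UK where "UK = sum u K"
  \<comment> \<open>The mixing condition sums absolute values, so its error bound passes to every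
    set of times, in particular to \<open>K\<close>.\<close>
  have deviation: "\<bar>(\<Sum>j\<in>S. measure M (A \<inter> (T ^^ j) ` D)) - measure M A * measure M D * sum u S\<bar> \<le> \<eta> * \<alpha>"
    if "D \<in> {A, B}" "S \<subseteq> {..<N}" for D S
  proof -
    let ?g = "\<lambda>j. measure M (A \<inter> (T ^^ j) ` D) - measure M A * measure M D * u j"
    have "\<bar>sum ?g S\<bar> \<le> (\<Sum>j\<in>S. \<bar>?g j\<bar>)" by (rule sum_abs)
    also have "\<dots> \<le> (\<Sum>j<N. \<bar>?g j\<bar>)"
      using that(2) by (intro sum_mono2) auto
    also have "\<dots> \<le> \<eta> * \<alpha>"
      unfolding \<alpha>_def by (rule close[OF that(1)])
    finally show ?thesis
      by (simp add: sum_subtractf sum_distrib_left)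
  qed
  have \<alpha>: "0 \<le> \<alpha>" "\<alpha> = sum u {..<N}"
    by (auto simp: \<alpha>_def a_coeff_def u_def u_coeff_def intro!: sum_nonneg)
  have UK: "0 \<le> UK"
    by (auto simp: UK_def u_def u_coeff_def intro!: sum_nonneg)
  have sq: "9 / 10 * (w m)\<^sup>2 \<le> measure M A * measure M D" "measure M A * measure M D \<le> (w m)\<^sup>2"
    if "D \<in> {A, B}" for D
  proof -
    have "(19 / 20 * w m) * (19 / 20 * w m) \<le> measure M A * measure M D"
      using that \<mu>A \<mu>B width_pos[of m] by (intro mult_mono) auto
    then have "361 / 400 * (w m)\<^sup>2 \<le> measure M A * measure M D"
      by (simp add: power2_eq_square)
    then show "9 / 10 * (w m)\<^sup>2 \<le> measure M A * measure M D"
      using zero_le_power2[of "w m"] by linarith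
    show "measure M A * measure M D \<le> (w m)\<^sup>2"
      unfolding power2_eq_square using that \<mu>A \<mu>B width_pos[of m] by (intro mult_mono) auto
  qed
  have "measure M A * measure M A * \<alpha> \<le> Q + \<eta> * \<alpha>"
    using deviation[of A "{..<N}"] K(2) \<alpha>(2) by simp
  moreover have "9 / 10 * (w m)\<^sup>2 * \<alpha> \<le> measure M A * measure M A * \<alpha>"
    using sq(1)[of A] \<alpha>(1) by (intro mult_right_mono) auto
  \<comment> \<open>\<open>9 / 10 * (w m)\<^sup>2\<close> equals \<open>18 * \<eta>\<close>, and one
    \<open>\<eta> * \<alpha>\<close> is absorbed from the right.\<close>
  ultimately have \<eta>\<alpha>: "17 * (\<eta> * \<alpha>) \<le> Q"
    by (simp add: \<eta>_def)
  have "3 / 8 * Q \<le> measure M A * measure M A * UK + \<eta> * \<alpha>"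
    using deviation[of A K] K(1,3) by (simp add: UK_def)
  moreover have "measure M A * measure M A * UK \<le> (w m)\<^sup>2 * UK"
    using sq(2)[of A] UK by (intro mult_right_mono) auto
  moreover have "measure M A * measure M B * UK \<le> Q / 20 + \<eta> * \<alpha>"
    using deviation[of B K] K(1,4) by (simp add: UK_def)
  moreover have "9 / 10 * (w m)\<^sup>2 * UK \<le> measure M A * measure M B * UK"
    using sq(1)[of B] UK by (intro mult_right_mono) auto
  \<comment> \<open>The correlations of \<open>A\<close> with itself force
    \<open>(w m)\<^sup>2 * UK\<close> to be at least \<open>(3 / 8 - 1 / 17) * Q\<close>, while
    those with \<open>B\<close> force it to be at most
    \<open>10 / 9 * (1 / 20 + 1 / 17) * Q\<close>, which is smaller.\<close>
  ultimately show False
    using \<eta>\<alpha> Q by simp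
qed

end

theorem theorem4p4:
  fixes r :: "nat \<Rightarrow> nat" and s :: "nat \<Rightarrow> nat \<Rightarrow> nat"
    and C :: "nat \<Rightarrow> column" and T :: "real \<Rightarrow> real"
  assumes "rank_one r s C T"
    and "almost_steep r s C"
    and "summable (\<lambda>n. 1 / real (r n))"
  shows "\<not> rationally_weakly_mixing (column_space C) T"
proof -
  interpret almost_steep_rank_one r s C T
    by standard fact+
  show ?thesis
    using assms(3) by (rule not_rationally_weakly_mixing)
qed

end
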